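(* Two r.e. sets belonging to the same Turing-reducibility equivalence class need not belong to the same uniformity equivalence class; that is, there exist r.e. sets $A,B\subseteq\mathbb{N}$ such that $A\equiv_T B$ but $A\not\sim B$.
   Context: $\mathbb{N}=\{1,2,3,\dots\}$. $A\equiv_T B$ denotes Turing equivalence. A listing of an r.e. set $A\subseteq\mathbb{N}$ is a bijective computable function onto $A$: if $A$ is infinite it is a total computable bijection $h:\mathbb{N}\to A$; if $A$ is finite with $n$ elements it is a bijection $h:\{1,\dots,n\}\to A$. Two listings $h,g$ with the same domain are uniform, $h\sim g$, if $h(i)<h(j)\Leftrightarrow g(i)<g(j)$ for all $i,j$ in the domain. Two r.e. sets $A,B$ of equal cardinality are uniform, $A\sim B$, if there exist a listing $h$ of $A$ and a listing $g$ of $B$ with $h\sim g$. The uniformity equivalence class of $A$ is $[A]_\sim=\{B\subseteq\mathbb{N}: A\sim B\}$. *)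

theory Defs
  imports Main "HOL-Library.Nat_Bijection" "HOL-Library.Equipollence"
begin

(* Partial functions are maps; f n = None means that f n diverges.  Everything is
   unary: a k-ary function is a unary function of the Cantor code prod_encode of its
   arguments.  The pairing function and its projections are among the basic functions,
   so this gives exactly the usual partial recursive functions (relative to the set X). *)

definition char_fun :: "nat set \<Rightarrow> nat \<rightharpoonup> nat" where
  "char_fun X = (\<lambda>n. Some (if n \<in> X then 1 else 0))"

definition pair_pf :: "(nat \<rightharpoonup> nat) \<Rightarrow> (nat \<rightharpoonup> nat) \<Rightarrow> (nat \<rightharpoonup> nat)" where
  "pair_pf f g = (\<lambda>n. case f n of None \<Rightarrow> None | Some x \<Rightarrow>
     (case g n of None \<Rightarrow> None | Some y \<Rightarrow> Some (prod_encode (x, y))))"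

fun prim_rec_pf :: "(nat \<rightharpoonup> nat) \<Rightarrow> (nat \<rightharpoonup> nat) \<Rightarrow> nat \<Rightarrow> nat \<Rightarrow> nat option" where
  "prim_rec_pf f g a 0 = f a"
| "prim_rec_pf f g a (Suc k) = (case prim_rec_pf f g a k of None \<Rightarrow> None
     | Some r \<Rightarrow> g (prod_encode (a, prod_encode (k, r))))"

(* The search for a zero diverges if a value before the first zero is undefined. *)
definition mu_pf :: "(nat \<rightharpoonup> nat) \<Rightarrow> (nat \<rightharpoonup> nat)" where
  "mu_pf f = (\<lambda>a.
     if \<exists>n. f (prod_encode (a, n)) = Some 0 \<and> (\<forall>m<n. f (prod_encode (a, m)) \<noteq> None)
     then Some (LEAST n. f (prod_encode (a, n)) = Some 0) else None)"

inductive partial_recursive_in :: "nat set \<Rightarrow> (nat \<rightharpoonup> nat) \<Rightarrow> bool" for X :: "nat set" where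
  query: "partial_recursive_in X (char_fun X)"
| zero: "partial_recursive_in X (\<lambda>n. Some 0)"
| succ: "partial_recursive_in X (\<lambda>n. Some (Suc n))"
| left: "partial_recursive_in X (\<lambda>n. Some (fst (prod_decode n)))"
| right: "partial_recursive_in X (\<lambda>n. Some (snd (prod_decode n)))"
| pair: "partial_recursive_in X f \<Longrightarrow> partial_recursive_in X g \<Longrightarrow>
    partial_recursive_in X (pair_pf f g)"
| comp: "partial_recursive_in X f \<Longrightarrow> partial_recursive_in X g \<Longrightarrow>
    partial_recursive_in X (f \<circ>\<^sub>m g)"
| prim_rec: "partial_recursive_in X f \<Longrightarrow> partial_recursive_in X g \<Longrightarrow>
    partial_recursive_in X
      (\<lambda>n. prim_rec_pf f g (fst (prod_decode n)) (snd (prod_decode n)))"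
| mu: "partial_recursive_in X f \<Longrightarrow> partial_recursive_in X (mu_pf f)"

(* Querying the empty set only contributes the constant function 0. *)
definition partial_recursive :: "(nat \<rightharpoonup> nat) \<Rightarrow> bool" where
  "partial_recursive f \<longleftrightarrow> partial_recursive_in {} f"

definition recursively_enumerable :: "nat set \<Rightarrow> bool" where
  "recursively_enumerable A \<longleftrightarrow> (\<exists>f. partial_recursive f \<and> dom f = A)"

definition turing_reducible :: "nat set \<Rightarrow> nat set \<Rightarrow> bool" (infix "\<le>\<^sub>T" 50) where
  "A \<le>\<^sub>T B \<longleftrightarrow> partial_recursive_in B (char_fun A)"

definition turing_equivalent :: "nat set \<Rightarrow> nat set \<Rightarrow> bool" (infix "\<equiv>\<^sub>T" 50) where
  "A \<equiv>\<^sub>T B \<longleftrightarrow> A \<le>\<^sub>T B \<and> B \<le>\<^sub>T A"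

(* Sets are sets of positive integers, and listings are indexed from 1; a listing is
   undefined outside its index set, in particular at 0. *)
definition listing :: "(nat \<rightharpoonup> nat) \<Rightarrow> nat set \<Rightarrow> bool" where
  "listing h A \<longleftrightarrow> partial_recursive h \<and>
     dom h = (if finite A then {1..card A} else {1..}) \<and>
     bij_betw (\<lambda>i. the (h i)) (dom h) A"

definition uniform_listings :: "(nat \<rightharpoonup> nat) \<Rightarrow> (nat \<rightharpoonup> nat) \<Rightarrow> bool" where
  "uniform_listings h g \<longleftrightarrow> dom h = dom g \<and>
     (\<forall>i\<in>dom h. \<forall>j\<in>dom h. the (h i) < the (h j) \<longleftrightarrow> the (g i) < the (g j))"

definition uniform :: "nat set \<Rightarrow> nat set \<Rightarrow> bool" where
  "uniform A B \<longleftrightarrow> (\<exists>h g. listing h A \<and> listing g B \<and> uniform_listings h g)"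

end

theory Submission
  imports Defs
begin

text \<open>
  Let \<open>K\<close> be an r.e. set that is not recursive, let \<open>A\<close> consist of all numbers \<open>2e + 1\<close> together
  with the numbers \<open>2e + 2\<close> for \<open>e \<in> K\<close>, and let \<open>B = A - {1}\<close>.  Clearly \<open>A\<close> and \<open>B\<close> are Turing
  equivalent.  If \<open>h\<close> and \<open>g\<close> are uniform listings of \<open>A\<close> and \<open>B\<close>, then \<open>h i \<mapsto> g i\<close> is the order
  isomorphism from \<open>A\<close> onto \<open>B\<close>, which sends each element of \<open>A\<close> to the next one.  Hence \<open>e \<in> K\<close>
  holds iff \<open>g i = 2e + 2\<close> for the index \<open>i\<close> with \<open>h i = 2e + 1\<close>, and \<open>K\<close> would be recursive.

  The set \<open>K\<close> comes from a universal stack machine: \<open>e \<in> K\<close> iff the program \<open>e\<close>, run on input \<open>e\<close>,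
  halts with output \<open>0\<close>.  To refute that \<open>K\<close> is recursive it suffices that every defined value of a
  partial recursive function is found by some program of the machine.
\<close>

section \<open>Total recursive functions\<close>

abbreviation pfst :: "nat \<Rightarrow> nat" where
  "pfst n \<equiv> fst (prod_decode n)"

abbreviation psnd :: "nat \<Rightarrow> nat" where
  "psnd n \<equiv> snd (prod_decode n)"

definition computable_in :: "nat set \<Rightarrow> (nat \<Rightarrow> nat) \<Rightarrow> bool" where
  "computable_in X f \<longleftrightarrow> partial_recursive_in X (\<lambda>n. Some (f n))"

named_theorems computable

lemma computable_compose:
  assumes "computable_in X f" "computable_in X g"
  shows "computable_in X (\<lambda>n. f (g n))"
  using partial_recursive_in.comp[OF assms[unfolded computable_in_def]]
  by (simp add: computable_in_def map_comp_def)

lemma computable_pair [computable]: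
  assumes "computable_in X f" "computable_in X g"
  shows "computable_in X (\<lambda>n. prod_encode (f n, g n))"
  using partial_recursive_in.pair[OF assms[unfolded computable_in_def]]
  by (simp add: computable_in_def pair_pf_def)

lemma computable_pfst [computable]:
  "computable_in X f \<Longrightarrow> computable_in X (\<lambda>n. pfst (f n))"
  using computable_compose[of X pfst f] by (simp add: computable_in_def partial_recursive_in.left)

lemma computable_psnd [computable]:
  "computable_in X f \<Longrightarrow> computable_in X (\<lambda>n. psnd (f n))"
  using computable_compose[of X psnd f] by (simp add: computable_in_def partial_recursive_in.right)

lemma computable_Suc [computable]:
  "computable_in X f \<Longrightarrow> computable_in X (\<lambda>n. Suc (f n))"
  using computable_compose[of X Suc f] by (simp add: computable_in_def partial_recursive_in.succ)

text \<open>The identity is not among the basic functions; it arises by pairing the two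
  projections.\<close>

lemma computable_id [computable]: "computable_in X (\<lambda>n. n)"
proof -
  have "computable_in X (\<lambda>n. prod_encode (pfst n, psnd n))"
    by (intro computable_pair)
      (simp_all add: computable_in_def partial_recursive_in.left partial_recursive_in.right)
  then show ?thesis by simp
qed

lemma computable_const [computable]: "computable_in X (\<lambda>n. c)"
proof (induction c)
  case 0
  show ?case by (simp add: computable_in_def partial_recursive_in.zero)
next
  case (Suc c)
  then show ?case by (rule computable_Suc)
qed

lemma computable_rec_nat:
  assumes "computable_in X f" "computable_in X g" "computable_in X a" "computable_in X b"
  shows "computable_in X (\<lambda>n. rec_nat (f (a n))
    (\<lambda>k r. g (prod_encode (a n, prod_encode (k, r)))) (b n))"
proof -
  have "prim_rec_pf (\<lambda>n. Some (f n)) (\<lambda>n. Some (g n)) x k =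
      Some (rec_nat (f x) (\<lambda>k r. g (prod_encode (x, prod_encode (k, r)))) k)" for x k
    by (induction k) auto
  then have "computable_in X (\<lambda>n. rec_nat (f (pfst n))
      (\<lambda>k r. g (prod_encode (pfst n, prod_encode (k, r)))) (psnd n))"
    using partial_recursive_in.prim_rec[OF assms(1,2)[unfolded computable_in_def]]
    by (simp add: computable_in_def)
  from computable_compose[OF this computable_pair[OF assms(3,4)]] show ?thesis
    by simp
qed

lemma computable_funpow:
  assumes "computable_in X f" "computable_in X a" "computable_in X b"
  shows "computable_in X (\<lambda>n. (f ^^ b n) (a n))"
proof -
  have "computable_in X (\<lambda>n. rec_nat (a n)
      (\<lambda>k r. f (psnd (psnd (prod_encode (a n, prod_encode (k, r)))))) (b n))"
    by (rule computable_rec_nat[of X "\<lambda>n. n" "\<lambda>n. f (psnd (psnd n))"])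
      (intro computable assms computable_compose[OF assms(1)])+
  moreover have "rec_nat x (\<lambda>k r. f r) k = (f ^^ k) x" for x k
    by (induction k) auto
  ultimately show ?thesis by simp
qed

text \<open>A recursion on \<open>c n\<close> starts with \<open>f n\<close> and overwrites it with
  \<open>g n\<close> in every round, so it decides whether there is any round.\<close>

lemma computable_if_zero:
  assumes "computable_in X c" "computable_in X f" "computable_in X g"
  shows "computable_in X (\<lambda>n. if c n = 0 then f n else g n)"
proof -
  have "computable_in X (\<lambda>n. rec_nat (f n)
      (\<lambda>k r. g (pfst (prod_encode (n, prod_encode (k, r))))) (c n))"
    by (rule computable_rec_nat[of X f "\<lambda>n. g (pfst n)" "\<lambda>n. n"])
      (intro computable assms computable_compose[OF assms(3)])+
  moreover have "rec_nat x (\<lambda>k r. y) k = (if k = 0 then x else y)" for x y k :: nat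
    by (cases k) auto
  ultimately show ?thesis by simp
qed

lemma computable_pred [computable]:
  assumes "computable_in X f"
  shows "computable_in X (\<lambda>n. f n - 1)"
proof -
  \<comment> \<open>Each round returns its own counter, and the counter of the last round is the
    predecessor.\<close>
  have "computable_in X (\<lambda>n. rec_nat 0
      (\<lambda>k r. pfst (psnd (prod_encode (n, prod_encode (k, r))))) (f n))"
    by (rule computable_rec_nat[of X "\<lambda>n. 0" "\<lambda>n. pfst (psnd n)" "\<lambda>n. n"])
      (intro computable assms)+
  moreover have "rec_nat 0 (\<lambda>k r. k) m = m - 1" for m :: nat
    by (cases m) auto
  ultimately show ?thesis by simp
qed

lemma computable_add [computable]:
  assumes "computable_in X f" "computable_in X g"
  shows "computable_in X (\<lambda>n. f n + g n)"
proof -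
  have "(Suc ^^ k) m = m + k" for m k
    by (induction k) auto
  then show ?thesis
    using computable_funpow[of X Suc f g] assms computable_Suc[OF computable_id]
    by (simp add: add.commute)
qed

lemma computable_diff:
  assumes "computable_in X f" "computable_in X g"
  shows "computable_in X (\<lambda>n. f n - g n)"
proof -
  have "((\<lambda>n. n - 1) ^^ k) m = m - k" for m k :: nat
    by (induction k) auto
  then show ?thesis
    using computable_funpow[of X "\<lambda>n. n - 1" f g] assms computable_pred[OF computable_id] by simp
qed

lemma computable_if_eq [computable]:
  assumes "computable_in X a" "computable_in X b" "computable_in X f" "computable_in X g"
  shows "computable_in X (\<lambda>n. if a n = b n then f n else g n)"
proof -
  \<comment> \<open>Subtraction is truncated, so both differences vanish only when the values are
    equal.\<close>
  have "computable_in X (\<lambda>n. if (a n - b n) + (b n - a n) = 0 then f n else g n)"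
    by (intro computable_if_zero computable_add computable_diff assms)
  moreover have "(a n - b n) + (b n - a n) = 0 \<longleftrightarrow> a n = b n" for n
    by auto
  ultimately show ?thesis by simp
qed

lemma computable_Least:
  assumes "computable_in X f" "\<And>a. \<exists>n. f (prod_encode (a, n)) = 0"
  shows "computable_in X (\<lambda>a. LEAST n. f (prod_encode (a, n)) = 0)"
  using partial_recursive_in.mu[OF assms(1)[unfolded computable_in_def]] assms(2)
  by (simp add: computable_in_def mu_pf_def)

lemma recursively_enumerable_ex_zero:
  assumes "computable_in {} f"
  shows "recursively_enumerable {a. \<exists>n. f (prod_encode (a, n)) = 0}"
  unfolding recursively_enumerable_def partial_recursive_def
proof (intro exI conjI)
  show "partial_recursive_in {} (mu_pf (\<lambda>n. Some (f n)))"
    using assms by (intro partial_recursive_in.mu) (simp add: computable_in_def)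
qed (auto simp: mu_pf_def split: if_splits)

section \<open>A universal stack machine\<close>

text \<open>
  A state is a pair of a value and a stack of instructions; the empty stack is \<open>0\<close>.  An instruction
  is a pair of a tag and its operands.  Tags 0 to 5, 8 and 9 are the operations that build partial
  recursive functions, in the order zero, successor, left, right, composition, pairing, primitive
  recursion and search; tags 6, 7 and 10 are the continuations that keep intermediate values.
\<close>

definition push :: "nat \<Rightarrow> nat \<Rightarrow> nat" where
  "push i k = Suc (prod_encode (i, k))"

text \<open>Tag 6 holds the second program of a pair and the saved argument; tag 7 holds the first
  component of a pair to be formed. For tag 8 with counter \<open>Suc m\<close>, two tags 7 turn the
  recursive value \<open>r\<close> into the code of \<open>(a, (m, r))\<close>. Tag 10 holds the
  searched program, the argument and the candidate under test.\<close>

definition exec :: "nat \<Rightarrow> nat \<Rightarrow> nat \<Rightarrow> nat \<Rightarrow> nat" where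
  "exec x t q k =
    (if t = 0 then prod_encode (0, k)
     else if t = 1 then prod_encode (Suc x, k)
     else if t = 2 then prod_encode (pfst x, k)
     else if t = 3 then prod_encode (psnd x, k)
     else if t = 4 then prod_encode (x, push (psnd q) (push (pfst q) k))
     else if t = 5 then
       prod_encode (x, push (pfst q) (push (prod_encode (6, prod_encode (psnd q, x))) k))
     else if t = 6 then prod_encode (psnd q, push (pfst q) (push (prod_encode (7, x)) k))
     else if t = 7 then prod_encode (prod_encode (q, x), k)
     else if t = 8 then
       (if psnd x = 0 then prod_encode (pfst x, push (pfst q) k)
        else prod_encode (prod_encode (pfst x, psnd x - 1),
          push (prod_encode (8, q)) (push (prod_encode (7, psnd x - 1))
            (push (prod_encode (7, pfst x)) (push (psnd q) k)))))
     else if t = 9 then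
       prod_encode (prod_encode (x, 0),
         push q (push (prod_encode (10, prod_encode (q, prod_encode (x, 0)))) k))
     else if x = 0 then prod_encode (psnd (psnd q), k)
     else prod_encode (prod_encode (pfst (psnd q), Suc (psnd (psnd q))),
       push (pfst q) (push (prod_encode (10, prod_encode (pfst q,
         prod_encode (pfst (psnd q), Suc (psnd (psnd q)))))) k)))"

text \<open>Halted states are fixed points, so running too long never loses the output.\<close>

definition step :: "nat \<Rightarrow> nat" where
  "step s = (if psnd s = 0 then s else
     exec (pfst s) (pfst (pfst (psnd s - 1))) (psnd (pfst (psnd s - 1))) (psnd (psnd s - 1)))"

lemma computable_step: "computable_in X step"
proof -
  have "computable_in X (\<lambda>s. step s)"
    unfolding step_def exec_def push_def by (intro computable)
  then show ?thesis by simp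
qed

lemma step_halted [simp]: "step (prod_encode (x, 0)) = prod_encode (x, 0)"
  by (simp add: step_def)

lemma step_push [simp]:
  "step (prod_encode (x, push (prod_encode (t, q)) k)) = exec x t q k"
  by (simp add: step_def push_def)

section \<open>Runs of the machine\<close>

definition reaches :: "nat \<Rightarrow> nat \<Rightarrow> bool" where
  "reaches s t \<longleftrightarrow> (\<exists>n. (step ^^ n) s = t)"

lemma reaches_refl: "reaches s s"
  unfolding reaches_def by (rule exI[of _ 0]) simp

lemma reaches_trans:
  assumes "reaches s t" "reaches t u"
  shows "reaches s u"
proof -
  obtain m n where "(step ^^ m) s = t" "(step ^^ n) t = u"
    using assms unfolding reaches_def by blast
  then have "(step ^^ (n + m)) s = u"
    by (simp add: funpow_add)
  then show ?thesis
    unfolding reaches_def ..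
qed

lemma reaches_step:
  assumes "reaches (step s) t"
  shows "reaches s t"
proof (rule reaches_trans[OF _ assms])
  show "reaches s (step s)"
    unfolding reaches_def by (rule exI[of _ 1]) simp
qed

text \<open>Halted states are fixed by \<open>step\<close>, so after \<open>m + n\<close> steps both
  outputs must appear in the same state.\<close>

lemma reaches_halted_unique:
  assumes "reaches s (prod_encode (x, 0))" "reaches s (prod_encode (y, 0))"
  shows "x = y"
proof -
  have fixed: "(step ^^ k) (prod_encode (z, 0)) = prod_encode (z, 0)" for k z
    by (induction k) auto
  obtain m n where "(step ^^ m) s = prod_encode (x, 0)" "(step ^^ n) s = prod_encode (y, 0)"
    using assms unfolding reaches_def by blast
  then have "(step ^^ (n + m)) s = prod_encode (x, 0)" "(step ^^ (m + n)) s = prod_encode (y, 0)"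
    by (simp_all only: funpow_add comp_apply fixed)
  then show ?thesis by (simp add: add.commute)
qed

text \<open>Quantifying over every remaining stack \<open>k\<close> lets programs serve as
  subroutines. Arguments where \<open>f\<close> diverges are unconstrained: the diagonal argument
  runs only a total decision function.\<close>

definition implements :: "nat \<Rightarrow> (nat \<rightharpoonup> nat) \<Rightarrow> bool" where
  "implements c f \<longleftrightarrow> (\<forall>x y k. f x = Some y \<longrightarrow>
     reaches (prod_encode (x, push c k)) (prod_encode (y, k)))"

lemma implementsI:
  "(\<And>x y k. f x = Some y \<Longrightarrow> reaches (exec x t q k) (prod_encode (y, k))) \<Longrightarrow>
    implements (prod_encode (t, q)) f"
  by (simp add: implements_def reaches_step)

lemma implementsD:
  "implements c f \<Longrightarrow> f x = Some y \<Longrightarrow> reaches (prod_encode (y, k)) t \<Longrightarrow>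
    reaches (prod_encode (x, push c k)) t"
  unfolding implements_def using reaches_trans by blast

text \<open>Induction on the counter, with the stack left arbitrary because the recursive call runs
  above the continuations pushed for it.\<close>

lemma implements_prim_rec:
  assumes "implements c f" "implements d g"
  shows "implements (prod_encode (8, prod_encode (c, d)))
    (\<lambda>n. prim_rec_pf f g (pfst n) (psnd n))"
proof -
  have "reaches (prod_encode (prod_encode (a, m), push (prod_encode (8, prod_encode (c, d))) k))
      (prod_encode (y, k))" if "prim_rec_pf f g a m = Some y" for a m y k
    using that
  proof (induction m arbitrary: y k)
    case 0
    then show ?case
      by - (rule reaches_step,
        simp add: exec_def implementsD[OF assms(1)] reaches_refl)
  next
    case (Suc m)
    then obtain r where r: "prim_rec_pf f g a m = Some r"
      "g (prod_encode (a, prod_encode (m, r))) = Some y"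
      by (auto split: option.splits)
    \<comment> \<open>What remains after the recursive call: build the argument of \<open>g\<close>
      from \<open>r\<close>, then run \<open>d\<close>.\<close>
    let ?k = "push (prod_encode (7, m)) (push (prod_encode (7, a)) (push d k))"
    have "reaches (prod_encode (r, ?k)) (prod_encode (y, k))"
      by (rule reaches_step, simp add: exec_def, rule reaches_step)
        (simp add: exec_def implementsD[OF assms(2) r(2)] reaches_refl)
    then have "reaches (prod_encode (prod_encode (a, m),
        push (prod_encode (8, prod_encode (c, d))) ?k)) (prod_encode (y, k))"
      using Suc.IH[OF r(1)] reaches_trans by blast
    then show ?case
      by - (rule reaches_step, simp add: exec_def)
  qed
  then have "reaches (prod_encode (prod_encode (pfst x, psnd x),
      push (prod_encode (8, prod_encode (c, d))) k)) (prod_encode (y, k))"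
    if "prim_rec_pf f g (pfst x) (psnd x) = Some y" for x y k
    using that by blast
  then show ?thesis
    by (simp add: implements_def)
qed

lemma implements_mu:
  assumes "implements c f"
  shows "implements (prod_encode (9, c)) (mu_pf f)"
  unfolding implements_def
proof (intro allI impI)
  fix a y k
  assume "mu_pf f a = Some y"
  then have ex: "\<exists>n. f (prod_encode (a, n)) = Some 0 \<and> (\<forall>m<n. f (prod_encode (a, m)) \<noteq> None)"
    and y: "y = (LEAST n. f (prod_encode (a, n)) = Some 0)"
    by (auto simp: mu_pf_def split: if_splits)
  from ex have zero: "f (prod_encode (a, y)) = Some 0"
    unfolding y by (auto intro: LeastI)
  \<comment> \<open>Candidates below \<open>y\<close> give defined nonzero values, so the loop
    passes over each of them.\<close>
  have nonzero: "\<exists>v. f (prod_encode (a, m)) = Some (Suc v)" if "m < y" for m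
  proof -
    have "f (prod_encode (a, m)) \<noteq> Some 0"
      using that not_less_Least unfolding y by blast
    moreover have "f (prod_encode (a, m)) \<noteq> None"
      using ex that unfolding y by (metis (mono_tags, lifting) Least_le order_less_le_trans)
    ultimately show ?thesis by (metis not0_implies_Suc option.exhaust)
  qed
  define loop where "loop m = prod_encode (prod_encode (a, m),
    push c (push (prod_encode (10, prod_encode (c, prod_encode (a, m)))) k))" for m
  \<comment> \<open>Backward induction: \<open>j\<close> is the distance from the candidate to the
    first zero.\<close>
  have "reaches (loop (y - j)) (prod_encode (y, k))" if "j \<le> y" for j
    using that
  proof (induction j)
    case 0
    show ?case
      unfolding loop_def diff_zero
      by (rule implementsD[OF assms zero], rule reaches_step) (simp add: exec_def reaches_refl)
  next
    case (Suc j)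
    then obtain v where v: "f (prod_encode (a, y - Suc j)) = Some (Suc v)"
      using nonzero[of "y - Suc j"] by auto
    have "Suc (y - Suc j) = y - j"
      using Suc.prems by simp
    then have "reaches (prod_encode (Suc v,
        push (prod_encode (10, prod_encode (c, prod_encode (a, y - Suc j)))) k))
        (prod_encode (y, k))"
      using Suc by - (rule reaches_step, simp add: exec_def loop_def)
    then show ?case
      unfolding loop_def by (rule implementsD[OF assms v])
  qed
  from this[of y] have "reaches (loop 0) (prod_encode (y, k))"
    by simp
  then show "reaches (prod_encode (a, push (prod_encode (9, c)) k)) (prod_encode (y, k))"
    by - (rule reaches_step, simp add: exec_def loop_def)
qed

lemma ex_implements:
  assumes "partial_recursive_in {} f"
  shows "\<exists>c. implements c f"
  using assms
proof induction
  \<comment> \<open>With the empty oracle this is the constant 0, so tag 0 computes it.\<close>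
  case query
  show ?case
    by (rule exI[of _ "prod_encode (0, 0)"], rule implementsI)
      (auto simp: char_fun_def exec_def reaches_refl)
next
  case zero
  show ?case
    by (rule exI[of _ "prod_encode (0, 0)"], rule implementsI)
      (auto simp: exec_def reaches_refl)
next
  case succ
  show ?case
    by (rule exI[of _ "prod_encode (1, 0)"], rule implementsI)
      (auto simp: exec_def reaches_refl)
next
  case left
  show ?case
    by (rule exI[of _ "prod_encode (2, 0)"], rule implementsI)
      (auto simp: exec_def reaches_refl)
next
  case right
  show ?case
    by (rule exI[of _ "prod_encode (3, 0)"], rule implementsI)
      (auto simp: exec_def reaches_refl)
next
  case (pair f g)
  then obtain c d where c: "implements c f" and d: "implements d g"
    by blast
  have "reaches (prod_encode (x, push (prod_encode (5, prod_encode (c, d))) k))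
      (prod_encode (prod_encode (u, v), k))" if "f x = Some u" "g x = Some v" for x u v k
  proof -
    have "reaches (prod_encode (v, push (prod_encode (7, u)) k))
        (prod_encode (prod_encode (u, v), k))"
      by - (rule reaches_step, simp add: exec_def reaches_refl)
    then have "reaches (prod_encode (u, push (prod_encode (6, prod_encode (d, x))) k))
        (prod_encode (prod_encode (u, v), k))"
      by - (rule reaches_step, simp add: exec_def implementsD[OF d that(2)])
    then show ?thesis
      by - (rule reaches_step, simp add: exec_def implementsD[OF c that(1)])
  qed
  then have "implements (prod_encode (5, prod_encode (c, d))) (pair_pf f g)"
    by (auto simp: implements_def pair_pf_def split: option.splits)
  then show ?case ..
next
  case (comp f g)
  then obtain c d where c: "implements c f" and d: "implements d g"
    by blast
  have "reaches (prod_encode (x, push (prod_encode (4, prod_encode (c, d))) k))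
      (prod_encode (v, k))" if "g x = Some u" "f u = Some v" for x u v k
    by - (rule reaches_step, simp add: exec_def implementsD[OF d that(1)] implementsD[OF c that(2)] reaches_refl)
  then have "implements (prod_encode (4, prod_encode (c, d))) (f \<circ>\<^sub>m g)"
    by (auto simp: implements_def map_comp_def split: option.splits)
  then show ?case ..
next
  case (prim_rec f g)
  then show ?case using implements_prim_rec by blast
next
  case (mu f)
  then show ?case using implements_mu by blast
qed

text \<open>Diagonalization: \<open>f\<close> tests whether program \<open>e\<close> on input
  \<open>e\<close> has halted with output 0 after \<open>n\<close> steps.\<close>

lemma ex_nonrecursive_enumeration:
  "\<exists>f. computable_in {} f \<and>
     \<not> computable_in {} (\<lambda>a. if \<exists>n. f (prod_encode (a, n)) = 0 then 1 else 0)"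
proof -
  define start where "start e = prod_encode (e, push e 0)" for e
  define run where "run p = (step ^^ psnd p) (start (pfst p))" for p
  \<comment> \<open>The value 1 keeps unfinished runs from counting as output 0.\<close>
  define f where "f p = (if psnd (run p) = 0 then pfst (run p) else 1)" for p
  define K where "K = {e. reaches (start e) (prod_encode (0, 0))}"
  have "computable_in {} (\<lambda>p. (step ^^ psnd p) (prod_encode (pfst p, Suc (prod_encode (pfst p, 0)))))"
    by (intro computable_funpow computable_step computable)
  then have "computable_in {} (\<lambda>p. run p)"
    by (simp add: run_def start_def push_def)
  then have f: "computable_in {} (\<lambda>p. f p)"
    unfolding f_def by (intro computable)
  have halted: "psnd s = 0 \<and> pfst s = 0 \<longleftrightarrow> s = prod_encode (0, 0)" for s
    by (metis prod.collapse prod_decode_inverse prod_encode_inverse fst_conv snd_conv)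
  have K: "(\<exists>n. f (prod_encode (e, n)) = 0) \<longleftrightarrow> e \<in> K" for e
    by (auto simp: f_def run_def K_def reaches_def halted[symmetric])
  have False if computable: "computable_in {} (\<lambda>e. if e \<in> K then 1 else 0)"
  proof -
    obtain c where "implements c (\<lambda>e. Some (if e \<in> K then 1 else 0))"
      using ex_implements computable unfolding computable_in_def by blast
    \<comment> \<open>Run on its own code, \<open>c\<close> outputs 1 if it lies in \<open>K\<close>
      and 0 otherwise, the opposite of what membership in \<open>K\<close> means.\<close>
    then have c: "reaches (start c) (prod_encode (if c \<in> K then 1 else 0, 0))"
      unfolding start_def implements_def by blast
    show False
    proof (cases "c \<in> K")
      case True
      then show False
        using c reaches_halted_unique[of "start c" 0 1] by (simp add: K_def)
    next
      case False
      then show False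
        using c by (simp add: K_def)
    qed
  qed
  then show ?thesis
    using f K by auto
qed

section \<open>Uniform listings\<close>

text \<open>A listing diverges at 0; shifting the index by one makes it a total function.\<close>

lemma listing_infinite:
  assumes "listing h A" "infinite A"
  shows "dom h = {1..}" "bij_betw (\<lambda>i. the (h i)) {1..} A"
    "computable_in {} (\<lambda>n. the (h (Suc n)))"
proof -
  show dom: "dom h = {1..}"
    using assms by (simp add: listing_def)
  show "bij_betw (\<lambda>i. the (h i)) {1..} A"
    using assms dom by (simp add: listing_def)
  have "partial_recursive_in {} (h \<circ>\<^sub>m (\<lambda>n. Some (Suc n)))"
    using assms by (intro partial_recursive_in.intros) (simp add: listing_def partial_recursive_def)
  moreover have "h (Suc n) = Some (the (h (Suc n)))" for n
  proof -
    have "Suc n \<in> dom h" using dom by simp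
    then show ?thesis by auto
  qed
  then have "h \<circ>\<^sub>m (\<lambda>n. Some (Suc n)) = (\<lambda>n. Some (the (h (Suc n))))"
    by (auto simp: map_comp_def)
  ultimately show "computable_in {} (\<lambda>n. the (h (Suc n)))"
    by (simp add: computable_in_def)
qed

text \<open>Both initial segments are injective images of one set of indices, so \<open>h i\<close>
  and \<open>g i\<close> have the same rank.\<close>

lemma card_below_eq:
  fixes h g :: "nat \<Rightarrow> nat"
  assumes h: "bij_betw h I A" and g: "bij_betw g I B"
    and mono: "\<And>i j. i \<in> I \<Longrightarrow> j \<in> I \<Longrightarrow> h i < h j \<longleftrightarrow> g i < g j" and "i \<in> I"
  shows "card {a \<in> A. a < h i} = card {b \<in> B. b < g i}"
proof -
  have "card (f ` {j \<in> I. g j < g i}) = card {j \<in> I. g j < g i}" if "bij_betw f I C"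
    for f :: "nat \<Rightarrow> nat" and C
    using that by (intro card_image) (auto simp: bij_betw_def inj_on_def)
  moreover have "{a \<in> A. a < h i} = h ` {j \<in> I. h j < h i}" "{b \<in> B. b < g i} = g ` {j \<in> I. g j < g i}"
    using h g by (auto simp: bij_betw_def)
  moreover have "{j \<in> I. h j < h i} = {j \<in> I. g j < g i}"
    using mono \<open>i \<in> I\<close> by auto
  ultimately show ?thesis
    using h g by simp
qed

text \<open>Deleting the least element lowers the rank of \<open>y\<close> by one. Equal ranks
  therefore make \<open>y\<close> the immediate successor of \<open>x\<close> in
  \<open>A\<close>.\<close>

lemma order_iso_delete_least:
  fixes A :: "nat set"
  assumes "m \<in> A" "\<And>a. a \<in> A \<Longrightarrow> m \<le> a" "x \<in> A" "y \<in> A - {m}"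
    and "card {a \<in> A. a < x} = card {b \<in> A - {m}. b < y}"
  shows "x < y" "{a \<in> A. x < a \<and> a < y} = {}"
proof -
  have "m < y" using assms(2,4) by force
  then have "{a \<in> A. a < y} = insert m {b \<in> A - {m}. b < y}"
    using assms(1) by auto
  then have card: "card {a \<in> A. a < y} = Suc (card {a \<in> A. a < x})"
    using assms(5) by simp
  show "x < y"
  proof (rule ccontr)
    assume "\<not> x < y"
    then have "card {a \<in> A. a < y} \<le> card {a \<in> A. a < x}"
      by (intro card_mono) auto
    with card show False by simp
  qed
  have "insert x {a \<in> A. a < x} = {a \<in> A. a < y}"
  proof (rule card_subset_eq)
    show "insert x {a \<in> A. a < x} \<subseteq> {a \<in> A. a < y}"
      using \<open>x < y\<close> assms(3) by auto
    show "card (insert x {a \<in> A. a < x}) = card {a \<in> A. a < y}"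
      by (simp add: card)
  qed simp
  then have "a = x \<or> a < x" if "a \<in> A" "a < y" for a
    using that by blast
  then show "{a \<in> A. x < a \<and> a < y} = {}"
    by force
qed

section \<open>Two sets differing only in their least element\<close>

theorem corollary3p5:
  "\<exists>A B :: nat set. A \<subseteq> {1..} \<and> B \<subseteq> {1..} \<and>
     recursively_enumerable A \<and> recursively_enumerable B \<and> A \<approx> B \<and>
     A \<equiv>\<^sub>T B \<and> \<not> uniform A B"
proof -
  obtain f where f: "computable_in {} f"
    and nonrec: "\<not> computable_in {} (\<lambda>a. if \<exists>n. f (prod_encode (a, n)) = 0 then 1 else 0)"
    using ex_nonrecursive_enumeration by blast
  define K where "K = {e. \<exists>n. f (prod_encode (e, n)) = 0}"
  define A where "A = {n. \<exists>e. n = Suc (e + e) \<or> n = Suc (Suc (e + e)) \<and> e \<in> K}"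
  define B where "B = A - {1}"
  \<comment> \<open>With \<open>p\<close> coding \<open>(x, (e, n))\<close>, the value is 0 exactly
    when \<open>(e, n)\<close> witnesses that \<open>x\<close> lies in \<open>A\<close>; 1 means
    failure.\<close>
  define a where "a p = (if pfst p = Suc (pfst (psnd p) + pfst (psnd p)) then 0
    else if pfst p = Suc (Suc (pfst (psnd p) + pfst (psnd p))) then f (psnd p) else 1)" for p
  have a: "computable_in {} (\<lambda>p. a p)"
    unfolding a_def by (intro computable computable_compose[OF f])
  have a_eq: "a (prod_encode (x, prod_encode (e, n))) = (if x = Suc (e + e) then 0
      else if x = Suc (Suc (e + e)) then f (prod_encode (e, n)) else 1)" for x e n
    by (simp add: a_def)
  have a_iff: "(\<exists>n. a (prod_encode (x, n)) = 0) \<longleftrightarrow> x \<in> A" for x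
  proof
    assume "\<exists>n. a (prod_encode (x, n)) = 0"
    then obtain e n where "a (prod_encode (x, prod_encode (e, n))) = 0"
      by (metis prod.collapse prod_decode_inverse)
    then show "x \<in> A"
      by (auto simp: a_eq A_def K_def split: if_splits)
  next
    assume "x \<in> A"
    then consider e where "x = Suc (e + e)"
      | e n where "x = Suc (Suc (e + e))" "f (prod_encode (e, n)) = 0"
      by (auto simp: A_def K_def)
    then show "\<exists>n. a (prod_encode (x, n)) = 0"
    proof cases
      case 1
      then show ?thesis
        by (intro exI[of _ "prod_encode (e, 0)"]) (simp add: a_eq)
    next
      case 2
      then show ?thesis
        by (intro exI[of _ "prod_encode (e, n)"]) (simp add: a_eq)
    qed
  qed
  have odd_in: "Suc (e + e) \<in> A" for e
    by (auto simp: A_def)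
  have even_in: "Suc (Suc (e + e)) \<in> A \<longleftrightarrow> e \<in> K" for e
  proof -
    have "Suc (e + e) \<noteq> d + d" "e + e = d + d \<longleftrightarrow> e = d" for d
      by presburger+
    then show ?thesis
      by (simp add: A_def)
  qed
  have one: "1 \<in> A"
    using odd_in[of 0] by simp
  have least: "1 \<le> x" if "x \<in> A" for x
    using that by (auto simp: A_def)
  have "infinite (range (\<lambda>e::nat. Suc (e + e)))"
    by (intro range_inj_infinite) (auto simp: inj_def)
  moreover have "range (\<lambda>e. Suc (e + e)) \<subseteq> A"
    using odd_in by auto
  ultimately have infA: "infinite A"
    using infinite_super by blast
  then have infB: "infinite B"
    by (simp add: B_def)
  have "recursively_enumerable A"
    using recursively_enumerable_ex_zero[OF a] by (simp add: a_iff)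
  moreover have "recursively_enumerable B"
  proof -
    have "computable_in {} (\<lambda>p. if pfst p = 1 then 1 else a p)"
      by (intro computable a)
    from recursively_enumerable_ex_zero[OF this]
    have "recursively_enumerable {x. \<exists>n. (if x = 1 then 1 else a (prod_encode (x, n))) = 0}"
      by simp
    moreover have "(\<exists>n. (if x = 1 then 1 else a (prod_encode (x, n))) = 0) \<longleftrightarrow> x \<in> B" for x
      by (cases "x = 1") (simp_all add: a_iff B_def)
    ultimately show ?thesis by simp
  qed
  moreover have "A \<approx> B"
  proof -
    have "insert 1 B \<approx> B"
      using infB by (rule infinite_insert_eqpoll)
    moreover have "insert 1 B = A"
      using one by (auto simp: B_def)
    ultimately show ?thesis by simp
  qed
  moreover have "A \<equiv>\<^sub>T B"
  proof -
    have red: "X \<le>\<^sub>T Y \<longleftrightarrow> computable_in Y (\<lambda>n. if n \<in> X then 1 else 0)" for X Y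
      by (simp add: turing_reducible_def computable_in_def char_fun_def)
    have char: "computable_in X (\<lambda>n. if n \<in> X then 1 else 0)" for X
      using partial_recursive_in.query[of X] by (simp add: computable_in_def char_fun_def)
    \<comment> \<open>The two sets differ only at 1, so each oracle's answer is corrected at that
      one point.\<close>
    have "(\<lambda>n. if n \<in> A then 1 else 0) =
        (\<lambda>n. if n = 1 then 1 else if n \<in> B then 1 else 0 :: nat)"
      using one by (auto simp: B_def)
    moreover have "computable_in B (\<lambda>n. if n = 1 then 1 else if n \<in> B then 1 else 0)"
      by (intro computable char)
    ultimately have "A \<le>\<^sub>T B"
      by (simp only: red)
    have "(\<lambda>n. if n \<in> B then 1 else 0) =
        (\<lambda>n. if n = 1 then 0 else if n \<in> A then 1 else 0 :: nat)"
      by (auto simp: B_def)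
    moreover have "computable_in A (\<lambda>n. if n = 1 then 0 else if n \<in> A then 1 else 0)"
      by (intro computable char)
    ultimately have "B \<le>\<^sub>T A"
      by (simp only: red)
    with \<open>A \<le>\<^sub>T B\<close> show ?thesis
      by (simp add: turing_equivalent_def)
  qed
  moreover have "\<not> uniform A B"
  proof
    assume "uniform A B"
    then obtain h g where h: "listing h A" and g: "listing g B" and hg: "uniform_listings h g"
      by (auto simp: uniform_def)
    note h = listing_infinite[OF h infA] and g = listing_infinite[OF g infB]
    define H where "H n = the (h (Suc n))" for n
    define G where "G n = the (g (Suc n))" for n
    have H: "computable_in {} H" and G: "computable_in {} G"
      using h(3) g(3) by (simp_all add: H_def[abs_def] G_def[abs_def])
    \<comment> \<open>\<open>G i\<close> is the next element of \<open>A\<close> after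
      \<open>H i\<close>, and the number directly after \<open>H i\<close> belongs to
      \<open>A\<close> iff \<open>e\<close> lies in \<open>K\<close>.\<close>
    have next_iff: "G i = Suc (Suc (e + e)) \<longleftrightarrow> e \<in> K" if i: "H i = Suc (e + e)" for e i
    proof -
      have "card {x \<in> A. x < H i} = card {x \<in> B. x < G i}"
        unfolding H_def G_def using hg h(1)
        by (intro card_below_eq[OF h(2) g(2)]) (auto simp: uniform_listings_def)
      moreover have "H i \<in> A" "G i \<in> B"
        using bij_betwE[OF h(2)] bij_betwE[OF g(2)] by (auto simp: H_def G_def)
      ultimately have lt: "Suc (e + e) < G i" and
        empty: "{x \<in> A. Suc (e + e) < x \<and> x < G i} = {}"
        using order_iso_delete_least[OF one least, of "H i" "G i"] unfolding B_def i by auto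
      show ?thesis
      proof
        assume "G i = Suc (Suc (e + e))"
        then show "e \<in> K"
          using \<open>G i \<in> B\<close> even_in by (auto simp: B_def)
      next
        assume "e \<in> K"
        then have "\<not> Suc (Suc (e + e)) < G i"
          using even_in empty by auto
        then show "G i = Suc (Suc (e + e))"
          using lt by simp
      qed
    qed
    \<comment> \<open>A zero of \<open>d\<close> is an index at which \<open>H\<close> lists the odd
      number of \<open>e\<close>; the search for it succeeds because \<open>H\<close> is onto
      \<open>A\<close>.\<close>
    define d where "d p = (if H (psnd p) = Suc (pfst p + pfst p) then 0 else 1 :: nat)" for p
    define idx where "idx e = (LEAST i. d (prod_encode (e, i)) = 0)" for e
    have d: "computable_in {} (\<lambda>p. d p)"
      unfolding d_def by (intro computable computable_compose[OF H])
    have ex: "\<exists>i. d (prod_encode (e, i)) = 0" for e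
    proof -
      obtain j where "j \<ge> 1" "the (h j) = Suc (e + e)"
        using h(2) odd_in[of e] unfolding bij_betw_def by force
      then have "H (j - 1) = Suc (e + e)"
        by (simp add: H_def)
      then show ?thesis
        by (intro exI[of _ "j - 1"]) (simp add: d_def)
    qed
    have "d (prod_encode (e, idx e)) = 0" for e
      unfolding idx_def using ex by (rule LeastI_ex)
    moreover have "d (prod_encode (e, i)) = 0 \<longleftrightarrow> H i = Suc (e + e)" for e i
      by (simp add: d_def)
    ultimately have "H (idx e) = Suc (e + e)" for e
      by blast
    then have dec: "G (idx e) = Suc (Suc (e + e)) \<longleftrightarrow> e \<in> K" for e
      by (rule next_iff)
    have "computable_in {} (\<lambda>e. idx e)"
      unfolding idx_def using d ex by (rule computable_Least)
    \<comment> \<open>Find the index of the odd number of \<open>e\<close>, then look at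
      \<open>G\<close> there: this would decide \<open>K\<close>.\<close>
    then have "computable_in {} (\<lambda>e. if G (idx e) = Suc (Suc (e + e)) then 1 else 0)"
      by (intro computable computable_compose[OF G])
    then show False
      using nonrec by (simp add: dec K_def)
  qed
  moreover have "A \<subseteq> {1..}" "B \<subseteq> {1..}"
    using least by (auto simp: B_def)
  ultimately show ?thesis by blast
qed

end
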